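(* If $f$ is a strictly locally 1-to-1 map from a hereditarily decomposable continuum $X$ into a continuum $Y$, then $Y$ is a 2-to-1 retract of a continuum.
   Context: A continuum is a (nonempty) connected, compact metric space. A map is a continuous function. A continuum is decomposable if it is the union of two proper subcontinua; it is hereditarily decomposable if each of its nondegenerate (more than one point) subcontinua is decomposable. A map is locally 1-to-1 if each point of its domain has a neighborhood on which the map is injective; it is strictly locally 1-to-1 if it is locally 1-to-1 but is not a homeomorphism onto its image (for a map on a compact space: it is not injective). A function is 2-to-1 if the preimage of each point of its image has exactly two points. A continuum $Y$ is a 2-to-1 retract (of a continuum) if there is a continuum $Z$ and a 2-to-1 retraction from $Z$ onto a subcontinuum of $Z$ that is homeomorphic to $Y$. *)

theory Defs
  imports "HOL-Analysis.Analysis"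
begin

definition continuum :: "'a::metric_space set \<Rightarrow> bool" where
  "continuum X \<longleftrightarrow> X \<noteq> {} \<and> compact X \<and> connected X"

definition subcontinuum :: "'a::metric_space set \<Rightarrow> 'a set \<Rightarrow> bool" where
  "subcontinuum K X \<longleftrightarrow> continuum K \<and> K \<subseteq> X"

definition nondegenerate :: "'a set \<Rightarrow> bool" where
  "nondegenerate X \<longleftrightarrow> (\<exists>x\<in>X. \<exists>y\<in>X. x \<noteq> y)"

definition decomposable :: "'a::metric_space set \<Rightarrow> bool" where
  "decomposable X \<longleftrightarrow>
     (\<exists>A B. subcontinuum A X \<and> A \<noteq> X \<and> subcontinuum B X \<and> B \<noteq> X \<and> X = A \<union> B)"

definition hereditarily_decomposable :: "'a::metric_space set \<Rightarrow> bool" where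
  "hereditarily_decomposable X \<longleftrightarrow>
     (\<forall>K. subcontinuum K X \<and> nondegenerate K \<longrightarrow> decomposable K)"

definition locally_one_to_one ::
    "'a::metric_space set \<Rightarrow> ('a \<Rightarrow> 'b::metric_space) \<Rightarrow> bool" where
  "locally_one_to_one X f \<longleftrightarrow>
     (\<forall>x\<in>X. \<exists>U. openin (top_of_set X) U \<and> x \<in> U \<and> inj_on f U)"

definition strictly_locally_one_to_one ::
    "'a::metric_space set \<Rightarrow> ('a \<Rightarrow> 'b::metric_space) \<Rightarrow> bool" where
  "strictly_locally_one_to_one X f \<longleftrightarrow>
     locally_one_to_one X f \<and> \<not> (\<exists>g. homeomorphism X (f ` X) f g)"

definition two_to_one :: "'a set \<Rightarrow> ('a \<Rightarrow> 'b) \<Rightarrow> bool" where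
  "two_to_one Z r \<longleftrightarrow> (\<forall>y \<in> r ` Z. card {z \<in> Z. r z = y} = 2)"

text \<open>
  HOL cannot quantify existentially over types, so the ambient space of the continuum \<open>Z\<close> is fixed
  to be the countable power of the reals, which contains a homeomorphic copy of every compact
  metric space. Lemma \<open>two_to_one_retract_of_continuumI\<close> below shows that nothing is lost:
  a \<open>Z\<close> living in any metric space will do.
\<close>

definition two_to_one_retract_of_continuum :: "'b::metric_space set \<Rightarrow> bool" where
  "two_to_one_retract_of_continuum Y \<longleftrightarrow>
     (\<exists>(Z :: (nat \<Rightarrow> real) set) W r.
        continuum Z \<and> subcontinuum W Z \<and> W homeomorphic Y \<and>
        retraction Z W r \<and> two_to_one Z r)"

lemma compact_homeomorphic_nat_real:
  fixes Z :: "'c::metric_space set"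
  assumes "compact Z"
  shows "\<exists>(h :: 'c \<Rightarrow> nat \<Rightarrow> real) g. homeomorphism Z (h ` Z) h g"
proof (cases "Z = {}")
  case True
  then show ?thesis by (auto simp: homeomorphism_def)
next
  case False
  have "\<exists>F. finite F \<and> F \<subseteq> Z \<and> Z \<subseteq> (\<Union>x\<in>F. ball x (1 / Suc n))" for n
    using assms by (metis compact_imp_seq_compact seq_compact_imp_totally_bounded
        of_nat_0_less_iff zero_less_Suc zero_less_divide_1_iff)
  then obtain F where F: "\<And>n. finite (F n)" "\<And>n. F n \<subseteq> Z"
      "\<And>n. Z \<subseteq> (\<Union>x\<in>F n. ball x (1 / Suc n))"
    by metis
  define D where "D = (\<Union>n. F n)"
  have "countable D" "D \<noteq> {}"
    using F False by (auto simp: D_def countable_finite)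
  then obtain d :: "nat \<Rightarrow> 'c" where d: "D = range d"
    using uncountable_def by blast
  define h where "h = (\<lambda>z n. dist z (d n))"
  have "continuous_on Z h"
    unfolding h_def by (intro continuous_intros)
  moreover have "inj_on h Z"
  proof (rule inj_onI, rule ccontr)
    fix x y assume xy: "x \<in> Z" "y \<in> Z" "h x = h y" "x \<noteq> y"
    then obtain n where n: "1 / Suc n < dist x y / 2"
      by (metis half_gt_zero nat_approx_posE zero_less_dist_iff)
    from F(3)[of n] xy(1) obtain p where p: "p \<in> F n" "dist p x < 1 / Suc n"
      by auto
    then obtain k where "p = d k" using d by (auto simp: D_def)
    with xy(3) have "dist x p = dist y p" by (metis h_def)
    moreover have "dist x y \<le> dist x p + dist y p" by (rule dist_triangle2)
    ultimately show False using p(2) n by (simp add: dist_commute)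
  qed
  ultimately show ?thesis
    using homeomorphism_compact[OF assms] by blast
qed

lemma two_to_one_retract_of_continuumI:
  fixes Z :: "'c::metric_space set" and Y :: "'b::metric_space set"
  assumes Z: "continuum Z" and W: "subcontinuum W Z" and WY: "W homeomorphic Y"
    and r: "retraction Z W r" and two: "two_to_one Z r"
  shows "two_to_one_retract_of_continuum Y"
proof -
  obtain h :: "'c \<Rightarrow> nat \<Rightarrow> real" and g where hg: "homeomorphism Z (h ` Z) h g"
    using compact_homeomorphic_nat_real Z continuum_def by blast
  have ch: "continuous_on Z h" and cg: "continuous_on (h ` Z) g"
    and gh: "\<And>z. z \<in> Z \<Longrightarrow> g (h z) = z"
    using hg by (auto simp: homeomorphism_def)
  have WZ: "W \<subseteq> Z" and rW: "\<And>z. z \<in> Z \<Longrightarrow> r z \<in> W" "\<And>w. w \<in> W \<Longrightarrow> r w = w"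
    and cr: "continuous_on Z r"
    using W r by (auto simp: subcontinuum_def retraction_def)
  let ?r = "h \<circ> r \<circ> g"
  have img: "continuum (h ` A)" if "continuum A" "A \<subseteq> Z" for A
    using that ch unfolding continuum_def
    by (metis compact_continuous_image connected_continuous_image continuous_on_subset
        image_is_empty)
  have "continuum (h ` Z)" "subcontinuum (h ` W) (h ` Z)"
    using img Z W WZ by (auto simp: subcontinuum_def)
  moreover have "h ` W homeomorphic Y"
  proof -
    have "homeomorphism W (h ` W) h g"
      using homeomorphism_of_subsets[OF hg WZ] by blast
    then show ?thesis
      by (meson WY homeomorphic_def homeomorphic_sym homeomorphic_trans)
  qed
  moreover have "retraction (h ` Z) (h ` W) ?r"
  proof -
    have "continuous_on (h ` Z) (r \<circ> g)"
      using gh by (intro continuous_on_compose cg continuous_on_subset[OF cr]) auto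
    moreover have "(r \<circ> g) ` h ` Z \<subseteq> Z"
      using gh rW WZ by auto
    ultimately have "continuous_on (h ` Z) (h \<circ> (r \<circ> g))"
      by (metis continuous_on_compose continuous_on_subset ch)
    then show ?thesis
      using WZ gh rW by (auto simp: retraction_def comp_assoc subset_iff)
  qed
  moreover have "two_to_one (h ` Z) ?r"
    unfolding two_to_one_def
  proof
    fix y assume "y \<in> ?r ` h ` Z"
    then obtain z where z: "z \<in> Z" "y = h (r z)" using gh by auto
    have "{v \<in> h ` Z. ?r v = y} = h ` {v \<in> Z. r v = r z}"
    proof -
      have "h (r v) = h (r z) \<longleftrightarrow> r v = r z" if "v \<in> Z" for v
        using that z gh rW WZ by (metis subsetD)
      then show ?thesis
        using z gh by auto
    qed
    moreover have "inj_on h {v \<in> Z. r v = r z}"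
      using gh by (intro inj_on_inverseI[of _ g]) auto
    ultimately show "card {v \<in> h ` Z. ?r v = y} = 2"
      using two z by (simp add: card_image two_to_one_def)
  qed
  ultimately show ?thesis
    unfolding two_to_one_retract_of_continuum_def by blast
qed

end

theory Submission
  imports Defs
begin

text \<open>
  Local injectivity keeps the pairs of distinct points with equal image away from the diagonal, so
  they form a compact set. Hence non-injectivity passes to intersections of chains of subcontinua,
  and there is a subcontinuum \<open>C\<close> of \<open>X\<close> that is minimal among those on which \<open>f\<close> is not injective
  (\<open>minimal_noninjective_subcontinuum\<close>). It is nondegenerate, hence \<open>C = A \<union> B\<close> with proper
  subcontinua \<open>A\<close> and \<open>B\<close>, and \<open>f\<close> is injective on each of them. So a fibre of \<open>f\<close> on \<open>C\<close> with more
  than one point consists of one point of \<open>A - B\<close> and one point of \<open>B - A\<close>. Let \<open>D\<close> be the set of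
  those latter points; it is compact, nonempty, and \<open>f\<close> maps \<open>C - D\<close> bijectively onto \<open>f ` C\<close>.

  A 2-to-1 retraction onto \<open>Y\<close> needs exactly one further point over each point of \<open>Y\<close>. Over
  \<open>f ` C\<close> it is supplied by \<open>C - D\<close>, with \<open>D\<close> glued to its image in \<open>Y\<close>; over \<open>Y - f ` C\<close> it is
  supplied by a second copy of \<open>Y\<close> glued along \<open>f ` C\<close>. Both glued sheets are realised inside
  \<open>Y \<times> \<real>\<close> by using the distance to the glued part as height, positive for one sheet and negative
  for the other (\<open>two_to_one_retract_by_added_sheets\<close>). For an arc wrapped once around a circle
  with only its endpoints identified, this gives a circle with an arc attached at one end, the arc
  being wound around the circle.
\<close>

section \<open>Intersections of chains of continua\<close>

lemma compact_chain_Inter_meets: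
  fixes \<F> :: "'a::t2_space set set"
  assumes ne: "\<F> \<noteq> {}" and cpt: "\<And>K. K \<in> \<F> \<Longrightarrow> compact K"
    and lin: "\<And>K L. K \<in> \<F> \<Longrightarrow> L \<in> \<F> \<Longrightarrow> K \<subseteq> L \<or> L \<subseteq> K"
    and G: "closed G" and meets: "\<And>K. K \<in> \<F> \<Longrightarrow> K \<inter> G \<noteq> {}"
  shows "\<Inter>\<F> \<inter> G \<noteq> {}"
proof -
  obtain K0 where K0: "K0 \<in> \<F>" using ne by blast
  have least: "\<exists>L\<in>\<F>. L \<subseteq> K0 \<and> L \<subseteq> \<Inter>\<F>'" if "finite \<F>'" "\<F>' \<subseteq> \<F>" for \<F>'
    using that
  proof (induction \<F>' rule: finite_induct)
    case empty
    then show ?case using K0 by auto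
  next
    case (insert K \<F>')
    then obtain L where L: "L \<in> \<F>" "L \<subseteq> K0" "L \<subseteq> \<Inter>\<F>'" by auto
    have K: "K \<in> \<F>" using insert.prems by simp
    from lin[OF K L(1)] show ?case
    proof
      assume "K \<subseteq> L"
      with K L show ?thesis by (intro bexI[of _ K]) auto
    next
      assume "L \<subseteq> K"
      with L show ?thesis by (intro bexI[of _ L]) auto
    qed
  qed
  have "(K0 \<inter> G) \<inter> \<Inter>\<F> \<noteq> {}"
  proof (rule compact_imp_fip)
    show "compact (K0 \<inter> G)" using cpt[OF K0] G by (rule compact_Int_closed)
    show "closed K" if "K \<in> \<F>" for K using cpt[OF that] by (rule compact_imp_closed)
    fix \<F>' assume "finite \<F>'" "\<F>' \<subseteq> \<F>"
    then obtain L where "L \<in> \<F>" "L \<subseteq> K0" "L \<subseteq> \<Inter>\<F>'" using least by blast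
    moreover obtain x where "x \<in> L" "x \<in> G" using meets[OF \<open>L \<in> \<F>\<close>] by blast
    ultimately have "x \<in> K0 \<inter> G \<inter> \<Inter>\<F>'" by auto
    then show "K0 \<inter> G \<inter> \<Inter>\<F>' \<noteq> {}" by blast
  qed
  then show ?thesis by blast
qed

text \<open>
  If the intersection split into disjoint closed parts \<open>A\<close> and \<open>B\<close>, every member of the chain,
  being connected, would contain points equidistant from \<open>A\<close> and \<open>B\<close>; by compactness so would the
  intersection, but no point of \<open>A \<union> B\<close> is equidistant from both.
\<close>

lemma connected_chain_Inter:
  fixes \<F> :: "'a::metric_space set set"
  assumes ne: "\<F> \<noteq> {}" and cpt: "\<And>K. K \<in> \<F> \<Longrightarrow> compact K"
    and conn: "\<And>K. K \<in> \<F> \<Longrightarrow> connected K"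
    and lin: "\<And>K L. K \<in> \<F> \<Longrightarrow> L \<in> \<F> \<Longrightarrow> K \<subseteq> L \<or> L \<subseteq> K"
  shows "connected (\<Inter>\<F>)"
proof (rule ccontr)
  have closed: "closed (\<Inter>\<F>)"
    using cpt by (intro closed_Inter) (auto intro: compact_imp_closed)
  assume "\<not> connected (\<Inter>\<F>)"
  then have "\<exists>A B. closed A \<and> closed B \<and> A \<noteq> {} \<and> B \<noteq> {} \<and> A \<union> B = \<Inter>\<F> \<and> A \<inter> B = {}"
    unfolding connected_closed_set[OF closed] not_not .
  then obtain A B where AB: "closed A" "closed B" "A \<noteq> {}" "B \<noteq> {}"
      "A \<union> B = \<Inter>\<F>" "A \<inter> B = {}"
    by (elim exE conjE)
  define \<phi> where "\<phi> x = infdist x A - infdist x B" for x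
  have cphi: "continuous_on S \<phi>" for S
    unfolding \<phi>_def by (intro continuous_intros)
  have negA: "\<phi> a < 0" if "a \<in> A" for a
  proof -
    have "a \<notin> B" using that AB(6) by blast
    then show ?thesis
      using that AB(2,4) infdist_pos_not_in_closed[of B a] by (simp add: \<phi>_def)
  qed
  have posB: "\<phi> b > 0" if "b \<in> B" for b
  proof -
    have "b \<notin> A" using that AB(6) by blast
    then show ?thesis
      using that AB(1,3) infdist_pos_not_in_closed[of A b] by (simp add: \<phi>_def)
  qed
  have "\<Inter>\<F> \<inter> {x. \<phi> x = 0} \<noteq> {}"
  proof (rule compact_chain_Inter_meets[OF ne cpt lin])
    show "closed {x. \<phi> x = 0}"
      using cphi by (intro closed_Collect_eq) auto
    fix K assume K: "K \<in> \<F>"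
    obtain a b where ab: "a \<in> A" "b \<in> B" using AB(3,4) by blast
    have "A \<union> B \<subseteq> K" unfolding AB(5) using K by (rule Inter_lower)
    then have abK: "a \<in> K" "b \<in> K" using ab by auto
    have "connected (\<phi> ` K)" using conn[OF K] cphi by (intro connected_continuous_image)
    then have "0 \<in> \<phi> ` K"
      using connectedD_interval[of "\<phi> ` K" "\<phi> a" "\<phi> b" 0] negA[OF ab(1)] posB[OF ab(2)] abK
      by auto
    then show "K \<inter> {x. \<phi> x = 0} \<noteq> {}" by auto
  qed
  then obtain x where x: "x \<in> \<Inter>\<F>" "\<phi> x = 0" by blast
  then have "x \<in> A \<or> x \<in> B" unfolding AB(5)[symmetric] by simp
  then show False using negA[of x] posB[of x] x(2) by auto
qed

section \<open>Minimal subcontinua on which a map is not injective\<close>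

text \<open>
  The pairs with equal image form a compact set. Discarding the open squares over neighbourhoods on
  which \<open>f\<close> is injective removes the diagonal and nothing else.
\<close>

lemma compact_noninjective_pairs:
  fixes f :: "'a::metric_space \<Rightarrow> 'b::metric_space"
  assumes X: "compact X" and f: "continuous_on X f" and loc: "locally_one_to_one X f"
  shows "compact {(x, y). x \<in> X \<and> y \<in> X \<and> x \<noteq> y \<and> f x = f y}" (is "compact ?N")
proof -
  have "\<exists>V. open V \<and> x \<in> V \<and> inj_on f (X \<inter> V)" if x: "x \<in> X" for x
  proof -
    obtain U where "openin (top_of_set X) U" and U: "x \<in> U" "inj_on f U"
      using bspec[OF loc[unfolded locally_one_to_one_def] x] by (elim exE conjE)
    then obtain V where "open V" "U = X \<inter> V" by (meson openin_open)
    then show ?thesis using U by (intro exI[of _ V]) simp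
  qed
  then obtain V where V: "\<And>x. x \<in> X \<Longrightarrow> open (V x) \<and> x \<in> V x \<and> inj_on f (X \<inter> V x)"
    by metis
  define E where "E = {p \<in> X \<times> X. dist (f (fst p)) (f (snd p)) \<in> {0}}"
  have "continuous_on (X \<times> X) (\<lambda>p. dist (f (fst p)) (f (snd p)))"
    by (intro continuous_intros continuous_on_compose2[OF f]) auto
  moreover have "closed (X \<times> X)" "compact (X \<times> X)"
    using X by (auto intro: compact_Times closed_Times compact_imp_closed)
  ultimately have "closed ((X \<times> X) \<inter> (\<lambda>p. dist (f (fst p)) (f (snd p))) -` {0})"
    by (intro continuous_closed_preimage) auto
  then have "compact ((X \<times> X) \<inter> ((X \<times> X) \<inter> (\<lambda>p. dist (f (fst p)) (f (snd p))) -` {0}))"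
    using \<open>compact (X \<times> X)\<close> by (intro compact_Int_closed)
  moreover have "(X \<times> X) \<inter> ((X \<times> X) \<inter> (\<lambda>p. dist (f (fst p)) (f (snd p))) -` {0}) = E"
    by (auto simp: E_def)
  ultimately have "compact E" by simp
  moreover have "?N = E - (\<Union>x\<in>X. V x \<times> V x)"
  proof (intro equalityI subsetI)
    fix p assume "p \<in> ?N"
    then obtain x y where p: "p = (x, y)" "x \<in> X" "y \<in> X" "x \<noteq> y" "f x = f y" by auto
    then have "\<not> (x \<in> V z \<and> y \<in> V z)" if "z \<in> X" for z
      using V[OF that] by (auto dest: inj_onD)
    then show "p \<in> E - (\<Union>x\<in>X. V x \<times> V x)" using p by (auto simp: E_def)
  next
    fix p assume "p \<in> E - (\<Union>x\<in>X. V x \<times> V x)"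
    then have "p \<in> E" and notin: "\<And>x. x \<in> X \<Longrightarrow> p \<notin> V x \<times> V x" by auto
    then obtain x y where p: "p = (x, y)" "x \<in> X" "y \<in> X" "f x = f y" by (auto simp: E_def)
    then have "x \<noteq> y" using notin[of x] V[of x] by auto
    then show "p \<in> ?N" using p by simp
  qed
  moreover have "open (\<Union>x\<in>X. V x \<times> V x)"
    using V by (intro open_UN open_Times ballI) auto
  ultimately show ?thesis by (simp add: compact_diff)
qed

text \<open>
  Non-injectivity on \<open>K\<close> means that the square \<open>K \<times> K\<close> meets the compact set of non-injective pairs,
  a condition that chains of compact sets hand on to their intersection.
\<close>

lemma minimal_noninjective_subcontinuum:
  fixes f :: "'a::metric_space \<Rightarrow> 'b::metric_space"
  assumes X: "continuum X" and f: "continuous_on X f" and loc: "locally_one_to_one X f"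
    and ninj: "\<not> inj_on f X"
  obtains C where "subcontinuum C X" "\<not> inj_on f C"
    "\<And>K. subcontinuum K C \<Longrightarrow> K \<noteq> C \<Longrightarrow> inj_on f K"
proof -
  define N where "N = {(x, y). x \<in> X \<and> y \<in> X \<and> x \<noteq> y \<and> f x = f y}"
  have N: "compact N"
    unfolding N_def using X f loc by (intro compact_noninjective_pairs) (auto simp: continuum_def)
  have ninj_iff: "\<not> inj_on f K \<longleftrightarrow> (K \<times> K) \<inter> N \<noteq> {}" if "K \<subseteq> X" for K
    using that by (auto simp: inj_on_def N_def)
  define \<A> where "\<A> = {K. subcontinuum K X \<and> \<not> inj_on f K}"
  \<comment> \<open>Zorn's lemma yields maximal sets, so it is applied to the complements.\<close>
  have "\<exists>M\<in>uminus ` \<A>. \<forall>S\<in>uminus ` \<A>. M \<subseteq> S \<longrightarrow> S = M"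
  proof (rule subset_Zorn_nonempty)
    show "uminus ` \<A> \<noteq> {}" using X ninj by (auto simp: \<A>_def subcontinuum_def)
    fix \<C> assume ne: "\<C> \<noteq> {}" and ch: "subset.chain (uminus ` \<A>) \<C>"
    define \<F> where "\<F> = uminus ` \<C>"
    have F: "\<F> \<noteq> {}" "\<And>K. K \<in> \<F> \<Longrightarrow> K \<in> \<A>"
      using ne ch by (auto simp: \<F>_def subset_chain_def)
    have lin: "K \<subseteq> L \<or> L \<subseteq> K" if KL: "K \<in> \<F>" "L \<in> \<F>" for K L
    proof -
      obtain S T where "S \<in> \<C>" "T \<in> \<C>" "K = - S" "L = - T"
        using KL by (auto simp: \<F>_def)
      moreover from this have "S \<subseteq> T \<or> T \<subseteq> S"
        using ch unfolding subset_chain_def by metis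
      ultimately show ?thesis by auto
    qed
    have FA: "compact K" "connected K" "K \<subseteq> X" "\<not> inj_on f K" if "K \<in> \<F>" for K
      using F(2)[OF that] by (auto simp: \<A>_def subcontinuum_def continuum_def)
    have "\<Inter>((\<lambda>K. K \<times> K) ` \<F>) \<inter> N \<noteq> {}"
    proof (rule compact_chain_Inter_meets)
      show "S \<inter> N \<noteq> {}" if S: "S \<in> (\<lambda>K. K \<times> K) ` \<F>" for S
      proof -
        obtain K where "K \<in> \<F>" "S = K \<times> K" using S by auto
        then show ?thesis using ninj_iff[OF FA(3)] FA(4) by simp
      qed
      show "S \<subseteq> T \<or> T \<subseteq> S" if ST: "S \<in> (\<lambda>K. K \<times> K) ` \<F>" "T \<in> (\<lambda>K. K \<times> K) ` \<F>" for S T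
      proof -
        obtain K L where "K \<in> \<F>" "L \<in> \<F>" "S = K \<times> K" "T = L \<times> L"
          using ST by auto
        then show ?thesis using lin[of K L] by auto
      qed
    qed (use F(1) FA(1) N in \<open>auto intro: compact_Times compact_imp_closed\<close>)
    then have meets: "(\<Inter>\<F> \<times> \<Inter>\<F>) \<inter> N \<noteq> {}" by auto
    have sub: "\<Inter>\<F> \<subseteq> X" using F(1) FA(3) by blast
    obtain K0 where K0: "K0 \<in> \<F>" using F(1) by blast
    have "compact (K0 \<inter> \<Inter>\<F>)"
      using FA(1) K0 by (intro compact_Int_closed closed_Inter) (auto intro: compact_imp_closed)
    moreover have "K0 \<inter> \<Inter>\<F> = \<Inter>\<F>" using K0 by blast
    ultimately have "compact (\<Inter>\<F>)" by simp
    moreover have "connected (\<Inter>\<F>)"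
      using F(1) FA lin by (intro connected_chain_Inter)
    ultimately have "\<Inter>\<F> \<in> \<A>"
      using meets sub ninj_iff[OF sub] by (auto simp: \<A>_def subcontinuum_def continuum_def)
    moreover have "\<Union>\<C> = - \<Inter>\<F>" by (auto simp: \<F>_def)
    ultimately show "\<Union>\<C> \<in> uminus ` \<A>" by blast
  qed
  then obtain C where C: "C \<in> \<A>" and "\<forall>K\<in>\<A>. - C \<subseteq> - K \<longrightarrow> - K = - C" by auto
  then have least: "K = C" if "K \<in> \<A>" "K \<subseteq> C" for K
    using that by auto
  show thesis
  proof
    show "subcontinuum C X" "\<not> inj_on f C" using C by (auto simp: \<A>_def)
    show "inj_on f K" if "subcontinuum K C" "K \<noteq> C" for K
      using that C least[of K] by (auto simp: \<A>_def subcontinuum_def)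
  qed
qed

section \<open>Adding a second sheet\<close>

text \<open>
  The continuum is \<open>Y\<close> at height \<open>0\<close> together with two sheets: a copy of \<open>Y\<close> that leaves height \<open>0\<close>
  off \<open>f ` C\<close>, and an image of \<open>C\<close> that leaves height \<open>0\<close> off \<open>D\<close>. Projection to height \<open>0\<close> is the
  retraction. Over a point of \<open>f ` C\<close> the first sheet adds nothing and the second adds one point,
  coming from the unique preimage in \<open>C - D\<close>; over any other point the first sheet adds one point
  and the second none. The sheets meet \<open>Y\<close> because \<open>C\<close> and \<open>D\<close> are nonempty, which makes the union
  connected.
\<close>

lemma two_to_one_retract_by_added_sheets:
  fixes Y :: "'b::metric_space set" and C :: "'a::metric_space set"
  assumes Y: "continuum Y" and C: "continuum C" and f: "continuous_on C f" and fY: "f ` C \<subseteq> Y"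
    and D: "closed D" "D \<noteq> {}" "D \<subseteq> C"
    and transversal: "\<And>y. y \<in> f ` C \<Longrightarrow> \<exists>!c. c \<in> C - D \<and> f c = y"
  shows "two_to_one_retract_of_continuum Y"
proof -
  define base where "base = (\<lambda>y. (y, 0::real)) ` Y"
  define up where "up = (\<lambda>y. (y, infdist y (f ` C))) ` Y"
  define down where "down = (\<lambda>c. (f c, - infdist c D)) ` C"
  define Z where "Z = base \<union> up \<union> down"
  define r where "r = (\<lambda>(y::'b, t::real). (y, 0::real))"
  have Yc: "Y \<noteq> {}" "compact Y" "connected Y" and Cc: "C \<noteq> {}" "compact C" "connected C"
    using Y C by (auto simp: continuum_def)
  have cont: "continuous_on Y (\<lambda>y. (y, 0::real))" "continuous_on Y (\<lambda>y. (y, infdist y (f ` C)))"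
    "continuous_on C (\<lambda>c. (f c, - infdist c D))"
    by (intro continuous_intros f)+
  have base: "compact base" "connected base" and up: "compact up" "connected up"
    and down: "compact down" "connected down"
    unfolding base_def up_def down_def
    by (intro compact_continuous_image connected_continuous_image cont Yc Cc)+
  have fC: "closed (f ` C)" "f ` C \<noteq> {}"
    using Cc f by (auto intro: compact_imp_closed compact_continuous_image)
  have "base \<inter> up \<noteq> {}"
  proof -
    obtain c where c: "c \<in> C" using Cc by blast
    then have "(f c, 0) \<in> up" unfolding up_def
      using fY by (intro image_eqI[of _ _ "f c"]) auto
    moreover have "(f c, 0) \<in> base" using fY c by (auto simp: base_def)
    ultimately show ?thesis by blast
  qed
  moreover have "base \<inter> down \<noteq> {}"
  proof -
    obtain d where d: "d \<in> D" using D by blast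
    then have "(f d, 0) \<in> down" unfolding down_def
      using D by (intro image_eqI[of _ _ d]) auto
    moreover have "(f d, 0) \<in> base" using fY d D by (auto simp: base_def)
    ultimately show ?thesis by blast
  qed
  ultimately have "connected Z"
    unfolding Z_def using base up down by (intro connected_Un) auto
  then have Zc: "continuum Z"
    using base up down Yc by (auto simp: continuum_def Z_def base_def intro!: compact_Un)
  have rbase: "r z \<in> base" if "z \<in> Z" for z
    using that fY by (auto simp: Z_def base_def up_def down_def r_def)
  show ?thesis
  proof (rule two_to_one_retract_of_continuumI)
    show "continuum Z" by (rule Zc)
    show "subcontinuum base Z"
      using base Yc by (auto simp: subcontinuum_def continuum_def Z_def base_def)
    show "base homeomorphic Y"
    proof -
      have "homeomorphism base Y fst (\<lambda>y. (y, 0))"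
        unfolding homeomorphism_def base_def by (auto intro!: continuous_intros simp: image_image)
      then show ?thesis by (auto simp: homeomorphic_def)
    qed
    have "continuous_on Z r"
      unfolding r_def case_prod_unfold by (intro continuous_intros)
    then show "retraction Z base r"
      unfolding retraction_def using rbase by (auto simp: Z_def base_def r_def)
    show "two_to_one Z r"
      unfolding two_to_one_def
    proof
      fix w assume "w \<in> r ` Z"
      then obtain y where y: "y \<in> Y" "w = (y, 0)" using rbase by (auto simp: base_def)
      have "\<exists>t. t \<noteq> 0 \<and> {z \<in> Z. r z = w} = {(y, 0), (y, t)}"
      proof (cases "y \<in> f ` C")
        case True
        obtain c where c: "c \<in> C" "c \<notin> D" "f c = y"
          and uniq: "\<And>c'. c' \<in> C \<Longrightarrow> c' \<notin> D \<Longrightarrow> f c' = y \<Longrightarrow> c' = c"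
          using transversal[OF True] by blast
        have "infdist c D \<noteq> 0"
          using infdist_pos_not_in_closed[OF D(1,2) c(2)] by simp
        moreover have "{z \<in> Z. r z = w} = {(y, 0), (y, - infdist c D)}"
        proof (intro equalityI subsetI)
          fix z assume "z \<in> {z \<in> Z. r z = w}"
          then have z: "z \<in> Z" "fst z = y" using y by (auto simp: r_def case_prod_unfold)
          then consider "z \<in> base" | "z \<in> up" | "z \<in> down" by (auto simp: Z_def)
          then show "z \<in> {(y, 0), (y, - infdist c D)}"
          proof cases
            case 3
            then obtain c' where c': "c' \<in> C" "z = (f c', - infdist c' D)" by (auto simp: down_def)
            show ?thesis
              by (cases "c' \<in> D") (use c' z uniq in auto)
          qed (use z True in \<open>auto simp: base_def up_def\<close>)
        qed (use y c in \<open>auto simp: Z_def base_def down_def r_def\<close>)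
        ultimately show ?thesis by (intro exI[of _ "- infdist c D"]) simp
      next
        case False
        then have "infdist y (f ` C) \<noteq> 0"
          using infdist_pos_not_in_closed[OF fC, of y] by simp
        moreover have "{z \<in> Z. r z = w} = {(y, 0), (y, infdist y (f ` C))}"
          using False y by (auto simp: Z_def base_def up_def down_def r_def)
        ultimately show ?thesis by blast
      qed
      then show "card {z \<in> Z. r z = w} = 2" by auto
    qed
  qed
qed

section \<open>Maps from hereditarily decomposable continua\<close>

theorem theorem2:
  fixes X :: "'a::metric_space set" and Y :: "'b::metric_space set" and f :: "'a \<Rightarrow> 'b"
  assumes "continuum X" and "hereditarily_decomposable X"
    and "continuum Y"
    and "continuous_on X f" and "f ` X \<subseteq> Y"
    and "strictly_locally_one_to_one X f"
  shows "two_to_one_retract_of_continuum Y"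
proof -
  have X: "compact X" using assms(1) by (simp add: continuum_def)
  have loc: "locally_one_to_one X f" and ninj: "\<not> inj_on f X"
    using assms(4,6) homeomorphism_compact[OF X] by (auto simp: strictly_locally_one_to_one_def)
  obtain C where C: "subcontinuum C X" "\<not> inj_on f C"
    and minimal: "\<And>K. subcontinuum K C \<Longrightarrow> K \<noteq> C \<Longrightarrow> inj_on f K"
    using minimal_noninjective_subcontinuum[OF assms(1,4) loc ninj] by blast
  have CX: "C \<subseteq> X" "continuum C" using C(1) by (auto simp: subcontinuum_def)
  have "nondegenerate C" using C(2) by (auto simp: nondegenerate_def inj_on_def)
  then have "decomposable C" using assms(2) C(1) by (auto simp: hereditarily_decomposable_def)
  then obtain A B where AB: "subcontinuum A C" "A \<noteq> C" "subcontinuum B C" "B \<noteq> C" "C = A \<union> B"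
    by (auto simp: decomposable_def)
  have injA: "inj_on f A" and injB: "inj_on f B" using minimal AB by auto
  have cptAB: "compact (A \<times> B)"
    using AB by (auto simp: subcontinuum_def continuum_def intro: compact_Times)
  \<comment> \<open>From each pair of points identified by \<open>f\<close> on \<open>C\<close>, \<open>D\<close> takes the one in \<open>B\<close>. Writing it as a
    projection of a compact set of pairs makes it compact.\<close>
  define N where "N = {(x, y). x \<in> X \<and> y \<in> X \<and> x \<noteq> y \<and> f x = f y}"
  define D where "D = snd ` (N \<inter> (A \<times> B))"
  have D_iff: "b \<in> D \<longleftrightarrow> b \<in> B \<and> (\<exists>a\<in>A. a \<noteq> b \<and> f a = f b)" for b
  proof -
    have AX: "A \<subseteq> X" and BX: "B \<subseteq> X" using CX(1) unfolding AB(5) by simp_all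
    have "b \<in> D \<longleftrightarrow> (\<exists>a. (a, b) \<in> N \<inter> (A \<times> B))"
      unfolding D_def by (auto simp: image_iff Bex_def)
    also have "\<dots> \<longleftrightarrow> b \<in> B \<and> (\<exists>a\<in>A. a \<noteq> b \<and> f a = f b)"
      unfolding N_def using AX BX by blast
    finally show ?thesis .
  qed
  have "compact N" unfolding N_def by (rule compact_noninjective_pairs[OF X assms(4) loc])
  then have "compact D"
    unfolding D_def by (intro compact_continuous_image compact_Int cptAB continuous_intros)
  show ?thesis
  proof (rule two_to_one_retract_by_added_sheets)
    show "continuum Y" "continuum C" by (fact assms CX)+
    show "continuous_on C f" "f ` C \<subseteq> Y"
      using assms(4,5) CX by (auto intro: continuous_on_subset)
    show "closed D" using \<open>compact D\<close> by (rule compact_imp_closed)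
    show "D \<subseteq> C" unfolding AB(5) by (auto simp: D_iff)
    \<comment> \<open>Two identified points lie neither both in \<open>A\<close> nor both in \<open>B\<close>, so one is in each.\<close>
    have cross: "c \<in> D \<or> c' \<in> D" if "c \<in> C" "c' \<in> C" "c \<noteq> c'" "f c = f c'" for c c'
      using that AB(5) injA injB unfolding D_iff inj_on_def by (metis Un_iff)
    show "D \<noteq> {}" using C(2) cross by (auto simp: inj_on_def)
    fix y assume "y \<in> f ` C"
    then obtain c where c: "c \<in> C" "f c = y" by auto
    have "\<exists>c'\<in>C - D. f c' = y"
    proof (cases "c \<in> D")
      case True
      then obtain a where a: "a \<in> A" "a \<noteq> c" "f a = f c" and "c \<in> B" by (auto simp: D_iff)
      then have "a \<notin> B" using injB by (auto dest: inj_onD)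
      then show ?thesis using a c AB(5) by (auto simp: D_iff)
    qed (use c in auto)
    then show "\<exists>!c. c \<in> C - D \<and> f c = y" using cross by auto
  qed
qed

end
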